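(* Let $T>0$ and $\gamma>L\ge0$, let $\Phi$ be an admissible DGF, and suppose that $B$ is such that $\int_0^\infty\frac{1}{B\Phi(x)}\,dx=1$. Let $\tilde{\boldsymbol k}=(\tilde k_1,\tilde k_2,\tilde k_3)\in\mathbb{R}_{>0}^3$ be a normalized parameter triple with respect to $\Phi$ and let $\tilde T>0$ satisfy $\hat{\mathbb T}(\Phi,\tilde{\boldsymbol k},0)\le\tilde T$. Suppose moreover that $\tilde k_1^2\ge8\tilde k_2$. If $\boldsymbol k=(k_1,k_2,k_3)$ is selected as $$k_1=\tilde k_1\sqrt{\gamma},\qquad k_2=\tilde k_2\,\gamma,\qquad k_3=\frac{\tilde k_3\sqrt{\gamma}}{\gamma-L}\cdot\frac{\tilde T}{T},$$ then $$\frac{T}{\hat{\mathbb T}(\Phi,\boldsymbol k,L)}\le\frac{\Bigl(\tilde k_1-\sqrt{\tilde k_1^2-8\tilde k_2}\Bigr)\tilde k_3\tilde T}{2B}\cdot\frac{\gamma}{\gamma-L}.$$ Moreover, if $\tilde T=\tilde T(\Phi,\tilde{\boldsymbol k})$, where $$\tilde T(\Phi,\boldsymbol k)=\begin{cases}\dfrac{\ln\frac{k_1+\sqrt{k_1^2-8k_2}}{k_1-\sqrt{k_1^2-8k_2}}}{2k_3\sqrt{k_1^2-8k_2}}\,C+\dfrac{k_1^2+4k_2}{2k_1k_2k_3}\,B,&k_1^2>8k_2,\\[8pt]\dfrac{C+6B}{k_1k_3},&k_1^2=8k_2,\end{cases}$$ then this upper bound (the right-hand side of the inequality) tends to $\frac{\gamma}{\gamma-L}$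 as $\tilde k_1\to\infty$ (with $\tilde k_2,\tilde k_3$ fixed).
   Context: A locally absolutely continuous function $\Phi:\mathbb{R}\to\mathbb{R}$ is a Differentiator Generating Function (DGF) if: (i) $\Phi$ is odd; (ii) $\Phi$ and $\Phi'$ are continuously differentiable on $\mathbb{R}\setminus\{0\}$; (iii) $\Phi'(x)>0$ for all $x\ne0$; (iv) $\lim_{x\to0}|\Phi'(x)|=\infty$; (v) $\lim_{x\to0}\left|\frac{2\Phi'(x)^3}{\Phi''(x)}\right|=1$. A DGF $\Phi$ is admissible if there exist constants $B>0$, $C>0$, $D\ge1$ such that (a) $\int_0^\infty\frac{1}{B\Phi(x)}\,dx\le1$; (b) $C\Phi'(x)\ge1$ for all $x\ne0$; (c) $2D|\Phi'(x)|^3\ge|\Phi''(x)|$ for all $x\ne0$. In the claim, $C$ is a constant as in (b). A triple $\boldsymbol k=(k_1,k_2,k_3)\in\mathbb{R}_{>0}^3$ is normalized with respect to an admissible DGF $\Phi$ if there exists $D\ge 1$ satisfying (c) such that $\overline L\ge1$, where $$\overline L=\begin{cases}\frac{k_2}{D}&\text{if }k_1^2\ge8k_2,\\[2pt] \frac{k_2}{D}\tanh\frac{\pi k_1}{2\sqrt{8k_2-k_1^2}}&\text{if }k_1^2<8k_2.\end{cases}$$ For $\epsilon>0$ put $\Phi_\epsilon(x)=\epsilon^{-1}\Phi(\epsilon^2x)$. For $\boldsymbol k=(k_1,k_2,k_3)\in\mathbb{R}_{>0}^3$ and $f:\mathbb{R}_{\ge0}\to\mathbb{R}$ continuously differentiable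 with Lipschitz continuous $\dot f$ and $|\ddot f(t)|\le L$ for almost all $t$, consider the (differentiator error) system $$\dot x_1=-k_1\Phi_{k_3}(x_1)+x_2,\qquad \dot x_2=-2k_2\Phi_{k_3}(x_1)\Phi_{k_3}'(x_1)+\ddot f,$$ with solutions understood in the sense of Filippov (for $x_1=0$ the second equation reads $\dot x_2\in[-k_2,k_2]+\ddot f$). For a solution $\boldsymbol x(\cdot,\boldsymbol x_0,f)$ with $\boldsymbol x(0)=\boldsymbol x_0\in\mathbb{R}^2$, its convergence time is $\tau(\boldsymbol x_0,f)=\inf\{t\ge0:\boldsymbol x(\sigma,\boldsymbol x_0,f)=0\ \forall\sigma\ge t\}$ ($\inf\emptyset=\infty$). The convergence time function is $T_L^{\Phi,\boldsymbol k}(\boldsymbol x_0)=\sup_{|\ddot f|\le L}\tau(\boldsymbol x_0,f)$ (the supremum is over all such $f$ and, if solutions are not unique, also over all solutions), and the global convergence time is $\hat{\mathbb T}(\Phi,\boldsymbol k,L)=\sup_{\boldsymbol x_0\in\mathbb{R}^2}T_L^{\Phi,\boldsymbol k}(\boldsymbol x_0)\in[0,\infty]$. *)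

theory Defs
  imports "HOL-Analysis.Analysis"
begin

subsection \<open>Absolute continuity and Filippov solutions\<close>

text \<open>The \<open>\<epsilon>\<close>-\<open>\<delta>\<close> definition. A set \<open>\<D>\<close> with \<open>\<D> division_of \<Union>\<D>\<close> is an arbitrary
  finite family of non-overlapping compact intervals \<open>K = {Inf K..Sup K}\<close>.\<close>

definition abs_cont_on :: "real \<Rightarrow> real \<Rightarrow> (real \<Rightarrow> 'a::real_normed_vector) \<Rightarrow> bool" where
  "abs_cont_on a b g \<longleftrightarrow>
     (\<forall>\<epsilon>>0. \<exists>\<delta>>0. \<forall>\<D>. \<D> division_of \<Union>\<D> \<and> \<Union>\<D> \<subseteq> {a..b} \<and> (\<Sum>K\<in>\<D>. Sup K - Inf K) < \<delta>
        \<longrightarrow> (\<Sum>K\<in>\<D>. norm (g (Sup K) - g (Inf K))) < \<epsilon>)"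

definition local_abs_cont_on :: "real set \<Rightarrow> (real \<Rightarrow> 'a::real_normed_vector) \<Rightarrow> bool" where
  "local_abs_cont_on S g \<longleftrightarrow> (\<forall>a b. {a..b} \<subseteq> S \<longrightarrow> abs_cont_on a b g)"

definition filippov_set :: "('a::euclidean_space \<Rightarrow> 'a) \<Rightarrow> 'a \<Rightarrow> 'a set" where
  "filippov_set F x = (\<Inter>\<delta>\<in>{0<..}. \<Inter>N\<in>{N. negligible N}. closure (convex hull (F ` (ball x \<delta> - N))))"

text \<open>Filippov solutions on \<open>[0,\<infinity>)\<close> of \<open>x' = F t x\<close>; the values \<open>x t\<close> for \<open>t < 0\<close> are irrelevant.\<close>

definition filippov_solution ::
  "(real \<Rightarrow> 'a::euclidean_space \<Rightarrow> 'a) \<Rightarrow> (real \<Rightarrow> 'a) \<Rightarrow> bool" where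
  "filippov_solution F x \<longleftrightarrow>
     local_abs_cont_on {0..} x \<and>
     (AE t in lebesgue. 0 \<le> t \<longrightarrow>
        (\<exists>v. (x has_vector_derivative v) (at t) \<and> v \<in> filippov_set (F t) (x t)))"


subsection \<open>Differentiator generating functions\<close>

definition dgf :: "(real \<Rightarrow> real) \<Rightarrow> bool" where
  "dgf \<Phi> \<longleftrightarrow>
     local_abs_cont_on UNIV \<Phi> \<and>
     (\<forall>x. \<Phi> (- x) = - \<Phi> x) \<and>
     \<Phi> C1_differentiable_on (- {0}) \<and> deriv \<Phi> C1_differentiable_on (- {0}) \<and>
     (\<forall>x. x \<noteq> 0 \<longrightarrow> deriv \<Phi> x > 0) \<and>
     filterlim (\<lambda>x. \<bar>deriv \<Phi> x\<bar>) at_top (at 0) \<and>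
     ((\<lambda>x. \<bar>2 * deriv \<Phi> x ^ 3 / deriv (deriv \<Phi>) x\<bar>) \<longlongrightarrow> 1) (at 0)"

definition dgf_integral :: "(real \<Rightarrow> real) \<Rightarrow> real \<Rightarrow> ennreal" where
  "dgf_integral \<Phi> B = (\<integral>\<^sup>+x\<in>{0<..}. ennreal (1 / (B * \<Phi> x)) \<partial>lborel)"

definition dgf_slope_const :: "(real \<Rightarrow> real) \<Rightarrow> real \<Rightarrow> bool" where
  "dgf_slope_const \<Phi> C \<longleftrightarrow> C > 0 \<and> (\<forall>x. x \<noteq> 0 \<longrightarrow> C * deriv \<Phi> x \<ge> 1)"

definition dgf_curv_const :: "(real \<Rightarrow> real) \<Rightarrow> real \<Rightarrow> bool" where
  "dgf_curv_const \<Phi> D \<longleftrightarrow>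
     D \<ge> 1 \<and> (\<forall>x. x \<noteq> 0 \<longrightarrow> 2 * D * \<bar>deriv \<Phi> x\<bar> ^ 3 \<ge> \<bar>deriv (deriv \<Phi>) x\<bar>)"

definition admissible_dgf :: "(real \<Rightarrow> real) \<Rightarrow> bool" where
  "admissible_dgf \<Phi> \<longleftrightarrow>
     dgf \<Phi> \<and>
     (\<exists>B C D. B > 0 \<and> dgf_integral \<Phi> B \<le> 1 \<and> dgf_slope_const \<Phi> C \<and> dgf_curv_const \<Phi> D)"

definition L_bar :: "real \<Rightarrow> real \<Rightarrow> real \<Rightarrow> real" where
  "L_bar D k1 k2 =
     (if k1\<^sup>2 \<ge> 8 * k2 then k2 / D
      else k2 / D * tanh (pi * k1 / (2 * sqrt (8 * k2 - k1\<^sup>2))))"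

definition normalized_params :: "(real \<Rightarrow> real) \<Rightarrow> real \<Rightarrow> real \<Rightarrow> real \<Rightarrow> bool" where
  "normalized_params \<Phi> k1 k2 k3 \<longleftrightarrow>
     k1 > 0 \<and> k2 > 0 \<and> k3 > 0 \<and> (\<exists>D. dgf_curv_const \<Phi> D \<and> L_bar D k1 k2 \<ge> 1)"


subsection \<open>The differentiator error system and its convergence time\<close>

definition scaled :: "(real \<Rightarrow> real) \<Rightarrow> real \<Rightarrow> real \<Rightarrow> real" where
  "scaled \<Phi> \<epsilon> x = \<Phi> (\<epsilon>\<^sup>2 * x) / \<epsilon>"

text \<open>The right-hand side for \<open>f'' = w\<close>. The values on the line \<open>x\<^sub>1 = 0\<close>, where \<open>deriv \<Phi>\<close>
  does not exist, have no influence on the Filippov set, because the line is negligible.\<close>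

definition error_rhs ::
  "(real \<Rightarrow> real) \<Rightarrow> real \<Rightarrow> real \<Rightarrow> real \<Rightarrow> real \<Rightarrow> real \<times> real \<Rightarrow> real \<times> real" where
  "error_rhs \<Phi> k1 k2 k3 w = (\<lambda>(x1, x2).
     (- k1 * scaled \<Phi> k3 x1 + x2,
      - 2 * k2 * scaled \<Phi> k3 x1 * deriv (scaled \<Phi> k3) x1 + w))"

text \<open>Signals on \<open>[0,\<infinity>)\<close>; \<open>f'\<close> is the derivative of \<open>f\<close> (one-sided at \<open>0\<close>). By Rademacher's
  theorem \<open>f'\<close> is differentiable almost everywhere, and for \<open>t > 0\<close> its derivative is
  \<open>deriv (deriv f) t\<close>.\<close>

definition signal :: "real \<Rightarrow> (real \<Rightarrow> real) \<Rightarrow> bool" where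
  "signal L f \<longleftrightarrow>
     (\<exists>f'. (\<forall>t\<ge>0. (f has_real_derivative f' t) (at t within {0..})) \<and>
           continuous_on {0..} f' \<and> (\<exists>M. M-lipschitz_on {0..} f')) \<and>
     (AE t in lebesgue. 0 \<le> t \<longrightarrow> \<bar>deriv (deriv f) t\<bar> \<le> L)"

definition error_solution ::
  "(real \<Rightarrow> real) \<Rightarrow> real \<Rightarrow> real \<Rightarrow> real \<Rightarrow> (real \<Rightarrow> real) \<Rightarrow> (real \<Rightarrow> real \<times> real) \<Rightarrow> bool" where
  "error_solution \<Phi> k1 k2 k3 f x \<longleftrightarrow>
     filippov_solution (\<lambda>t. error_rhs \<Phi> k1 k2 k3 (deriv (deriv f) t)) x"

definition conv_time :: "(real \<Rightarrow> real \<times> real) \<Rightarrow> ennreal" where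
  "conv_time x = (INF t\<in>{t. 0 \<le> t \<and> (\<forall>\<sigma>\<ge>t. x \<sigma> = 0)}. ennreal t)"

definition conv_time_fun ::
  "(real \<Rightarrow> real) \<Rightarrow> real \<Rightarrow> real \<Rightarrow> real \<Rightarrow> real \<Rightarrow> real \<times> real \<Rightarrow> ennreal" where
  "conv_time_fun \<Phi> k1 k2 k3 L x0 =
     (SUP (f, x)\<in>{(f, x). signal L f \<and> error_solution \<Phi> k1 k2 k3 f x \<and> x 0 = x0}. conv_time x)"

definition global_conv_time ::
  "(real \<Rightarrow> real) \<Rightarrow> real \<Rightarrow> real \<Rightarrow> real \<Rightarrow> real \<Rightarrow> ennreal" where
  "global_conv_time \<Phi> k1 k2 k3 L = (SUP x0. conv_time_fun \<Phi> k1 k2 k3 L x0)"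

text \<open>Meaningful only for \<open>k1\<^sup>2 \<ge> 8 * k2\<close>: the \<open>else\<close> branch stands for \<open>k1\<^sup>2 = 8 * k2\<close>.
  The dependence on \<open>\<Phi>\<close> is through the constants \<open>B\<close> and \<open>C\<close>.\<close>

definition T_tilde :: "real \<Rightarrow> real \<Rightarrow> real \<Rightarrow> real \<Rightarrow> real \<Rightarrow> real" where
  "T_tilde B C k1 k2 k3 =
     (if k1\<^sup>2 > 8 * k2 then
        ln ((k1 + sqrt (k1\<^sup>2 - 8 * k2)) / (k1 - sqrt (k1\<^sup>2 - 8 * k2)))
          / (2 * k3 * sqrt (k1\<^sup>2 - 8 * k2)) * C
        + (k1\<^sup>2 + 4 * k2) / (2 * k1 * k2 * k3) * B
      else (C + 6 * B) / (k1 * k3))"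


subsection \<open>The Filippov inclusion of the error system in explicit form\<close>

lemma abs_cont_imp_isCont:
  fixes g :: "real \<Rightarrow> real"
  assumes "local_abs_cont_on UNIV g"
  shows "isCont g x"
  unfolding continuous_at_eps_delta
proof (intro allI impI)
  fix \<epsilon> :: real assume "\<epsilon> > 0"
  moreover have "abs_cont_on (x - 1) (x + 1) g"
    using assms by (simp add: local_abs_cont_on_def)
  ultimately obtain \<delta> where "\<delta> > 0" and \<delta>:
    "\<And>\<D>. \<D> division_of \<Union>\<D> \<Longrightarrow> \<Union>\<D> \<subseteq> {x-1..x+1} \<Longrightarrow> (\<Sum>K\<in>\<D>. Sup K - Inf K) < \<delta>
        \<Longrightarrow> (\<Sum>K\<in>\<D>. norm (g (Sup K) - g (Inf K))) < \<epsilon>"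
    unfolding abs_cont_on_def by meson
  have "dist (g y) (g x) < \<epsilon>" if y: "dist y x < min \<delta> 1" for y
  proof -
    define K where "K = cbox (min x y) (max x y)"
    have K: "K = {min x y..max x y}" "Sup K = max x y" "Inf K = min x y" "K \<noteq> {}"
      by (auto simp: K_def)
    have "{K} division_of \<Union>{K}"
      using division_of_self[of "min x y" "max x y"] K by (simp add: K_def)
    moreover have "\<Union>{K} \<subseteq> {x-1..x+1}" using y by (auto simp: K(1) dist_real_def)
    moreover have "(\<Sum>K\<in>{K}. Sup K - Inf K) < \<delta>" using y by (auto simp: K dist_real_def)
    ultimately have "(\<Sum>K\<in>{K}. norm (g (Sup K) - g (Inf K))) < \<epsilon>" by (rule \<delta>)
    then show ?thesis by (auto simp: K dist_real_def min_def max_def split: if_splits)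
  qed
  then show "\<exists>d>0. \<forall>y. dist y x < d \<longrightarrow> dist (g y) (g x) < \<epsilon>"
    using \<open>\<delta> > 0\<close> by (intro exI[of _ "min \<delta> 1"]) auto
qed

lemma C1_punctured_deriv:
  fixes f :: "real \<Rightarrow> real"
  assumes "f C1_differentiable_on (- {0})"
  shows "x \<noteq> 0 \<Longrightarrow> (f has_real_derivative deriv f x) (at x)"
    and "continuous_on (-{0}) (deriv f)"
proof -
  obtain D where D: "\<And>x. x \<noteq> 0 \<Longrightarrow> (f has_real_derivative D x) (at x)" "continuous_on (-{0}) D"
    using assms by (auto simp: C1_differentiable_on_def has_real_derivative_iff_has_vector_derivative)
  have e: "deriv f x = D x" if "x \<noteq> 0" for x using D(1)[OF that] by (rule DERIV_imp_deriv)
  show "x \<noteq> 0 \<Longrightarrow> (f has_real_derivative deriv f x) (at x)" using D e by simp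
  show "continuous_on (-{0}) (deriv f)" by (rule continuous_on_cong[THEN iffD2, OF refl _ D(2)]) (simp add: e)
qed

lemma dgf_prod_lim:
  assumes "dgf \<Phi>"
  shows "((\<lambda>x. \<Phi> x * deriv \<Phi> x) \<longlongrightarrow> 1/2) (at_right 0)"
proof -
  note D = assms[unfolded dgf_def]
  define d where "d = deriv \<Phi>"
  define e where "e = deriv d"
  have dP: "\<And>x. x \<noteq> 0 \<Longrightarrow> (\<Phi> has_real_derivative d x) (at x)"
    and dd: "\<And>x. x \<noteq> 0 \<Longrightarrow> (d has_real_derivative e x) (at x)"
    and ce: "continuous_on (-{0}) e"
    using D C1_punctured_deriv unfolding d_def e_def by blast+
  have dpos: "d x > 0" if "x \<noteq> 0" for x using D that by (auto simp: d_def)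
  have "filterlim (\<lambda>x. \<bar>d x\<bar>) at_top (at 0)" using D unfolding d_def by blast
  then have "filterlim (\<lambda>x. \<bar>d x\<bar>) at_top (at_right 0)"
    by (rule filterlim_mono[OF _ order_refl]) (simp add: at_le)
  moreover have "\<forall>\<^sub>F x in at_right 0. d x \<ge> \<bar>d x\<bar>"
    using eventually_at_right_less[of "0 :: real"]
  proof eventually_elim
    case (elim x)
    then show ?case using dpos[of x] by simp
  qed
  ultimately have dtop: "filterlim d at_top (at_right 0)" by (rule filterlim_at_top_mono)
  have "((\<lambda>x. \<bar>2 * d x ^ 3 / e x\<bar>) \<longlongrightarrow> 1) (at 0)" using D unfolding d_def e_def by blast
  then have r: "((\<lambda>x. \<bar>2 * d x ^ 3 / e x\<bar>) \<longlongrightarrow> 1) (at_right 0)"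
    by (rule filterlim_mono[OF _ order_refl]) (simp add: at_le)
  have "eventually (\<lambda>x. \<bar>2 * d x ^ 3 / e x\<bar> > 1/2) (at_right 0)"
    using r by (rule order_tendstoD) simp
  then have "eventually (\<lambda>x. e x \<noteq> 0) (at_right 0)" by eventually_elim auto
  then obtain b where "b > 0" and b: "\<And>x. 0 < x \<Longrightarrow> x < b \<Longrightarrow> e x \<noteq> 0"
    unfolding eventually_at_right_field by auto
  have eneg: "e x < 0" if x: "0 < x" "x < b" for x
  proof (rule ccontr)
    assume "\<not> e x < 0"
    then have ex: "e x > 0" using b[OF x] by simp
    have ep: "e y > 0" if y: "0 < y" "y \<le> x" for y
    proof (rule ccontr)
      assume "\<not> e y > 0"
      then have "e y \<le> 0" by simp
      then have "\<exists>z\<ge>y. z \<le> x \<and> e z = 0"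
        using ex y by (intro IVT') (auto intro!: continuous_on_subset[OF ce])
      then show False using b y x by (metis less_le_trans le_less_trans)
    qed
    have "eventually (\<lambda>y. d y > d x) (at_right 0)"
      using dtop by (simp add: filterlim_at_top_dense)
    moreover have "eventually (\<lambda>y. 0 < y \<and> y < x) (at_right 0)"
      using x(1) by (auto simp: eventually_at_right_field)
    ultimately have "eventually (\<lambda>y. d y > d x \<and> 0 < y \<and> y < x) (at_right 0)"
      by eventually_elim auto
    then obtain y where y: "d y > d x" "0 < y" "y < x"
      using eventually_happens'[of "at_right (0::real)"] by auto
    have "d y < d x"
      using y by (intro DERIV_pos_imp_increasing[of y x d]) (auto intro!: exI dd ep)
    with y show False by simp
  qed
  have ev: "eventually (\<lambda>x. 0 < x \<and> x < b) (at_right 0)"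
    using \<open>b > 0\<close> by (auto simp: eventually_at_right_field)
  have "\<Phi> 0 = 0" using D by (metis minus_zero equal_neg_zero)
  moreover have "isCont \<Phi> 0" using D abs_cont_imp_isCont by blast
  ultimately have P0: "(\<Phi> \<longlongrightarrow> 0) (at_right 0)"
    by (metis isCont_def filterlim_at_split)
  have "((\<lambda>x. \<Phi> x / inverse (d x)) \<longlongrightarrow> 1/2) (at_right 0)"
  proof (rule lhopital_right_0[where f' = d and g' = "\<lambda>x. - e x / (d x)^2"])
    show "(\<Phi> \<longlongrightarrow> 0) (at_right 0)" by fact
    show "((\<lambda>x. inverse (d x)) \<longlongrightarrow> 0) (at_right 0)"
      using dtop by (rule tendsto_inverse_0_at_top)
    show "\<forall>\<^sub>F x in at_right 0. inverse (d x) \<noteq> 0"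
      using ev
    proof eventually_elim
      case (elim x)
      then show ?case using dpos[of x] by simp
    qed
    show "\<forall>\<^sub>F x in at_right 0. - e x / (d x)\<^sup>2 \<noteq> 0"
      using ev
    proof eventually_elim
      case (elim x)
      then show ?case using dpos[of x] eneg[of x] by simp
    qed
    show "\<forall>\<^sub>F x in at_right 0. (\<Phi> has_real_derivative d x) (at x)"
      using ev by eventually_elim (use dP in auto)
    show "\<forall>\<^sub>F x in at_right 0. ((\<lambda>x. inverse (d x)) has_real_derivative - e x / (d x)\<^sup>2) (at x)"
      using ev
    proof eventually_elim
      case (elim x)
      then have "d x \<noteq> 0" "x \<noteq> 0" using dpos[of x] by auto
      then show ?case
        using DERIV_inverse_fun[OF dd, of x] by (simp add: divide_inverse power2_eq_square)
    qed
    have "((\<lambda>x. \<bar>2 * d x ^ 3 / e x\<bar> / 2) \<longlongrightarrow> 1/2) (at_right 0)"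
      by (intro tendsto_intros r) auto
    moreover have "\<forall>\<^sub>F x in at_right 0. \<bar>2 * d x ^ 3 / e x\<bar> / 2 = d x / (- e x / (d x)\<^sup>2)"
      using ev
    proof eventually_elim
      case (elim x)
      then have "d x > 0" "e x < 0" using dpos[of x] eneg[of x] by auto
      then show ?case by (simp add: abs_mult power2_eq_square power3_eq_cube)
    qed
    ultimately show "((\<lambda>x. d x / (- e x / (d x)\<^sup>2)) \<longlongrightarrow> 1/2) (at_right 0)"
      by (rule Lim_transform_eventually)
  qed
  moreover have "\<Phi> x / inverse (d x) = \<Phi> x * deriv \<Phi> x" for x
    unfolding d_def divide_inverse inverse_inverse_eq by (rule refl)
  ultimately show ?thesis by simp
qed

lemma filippov_set_memI:
  fixes F :: "'a::euclidean_space \<Rightarrow> 'a"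
  assumes "\<And>\<delta> N r. \<delta> > 0 \<Longrightarrow> negligible N \<Longrightarrow> r > 0 \<Longrightarrow>
     \<exists>z\<in>convex hull (F ` (ball x \<delta> - N)). dist z v < r"
  shows "v \<in> filippov_set F x"
  unfolding filippov_set_def
proof (intro INT_I)
  fix \<delta> :: real and N :: "'a set" assume "\<delta> \<in> {0<..}" "N \<in> {N. negligible N}"
  then have "\<delta> > 0" "negligible N" by simp_all
  then show "v \<in> closure (convex hull (F ` (ball x \<delta> - N)))"
    unfolding closure_approachable using assms[of \<delta> N] by (intro allI impI)
qed

lemma filippov_set_memD:
  assumes "v \<in> filippov_set F x" "\<delta> > 0" "negligible N" "closed S" "convex S"
    "\<And>y. y \<in> ball x \<delta> - N \<Longrightarrow> F y \<in> S"
  shows "v \<in> S"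
proof -
  have "v \<in> closure (convex hull (F ` (ball x \<delta> - N)))"
    using assms(1-3) by (auto simp: filippov_set_def)
  also have "\<dots> \<subseteq> S"
    using assms(4-6) by (intro closure_minimal hull_minimal) auto
  finally show ?thesis .
qed

lemma open_minus_negligible:
  fixes N U :: "'a::euclidean_space set"
  assumes "open U" "U \<noteq> {}" "negligible N"
  shows "\<exists>y. y \<in> U - N"
  using assms open_not_negligible negligible_subset by blast

lemma filippov_set_isCont:
  fixes F :: "'a::euclidean_space \<Rightarrow> 'a"
  assumes "isCont F x"
  shows "filippov_set F x = {F x}"
proof (intro equalityI subsetI)
  fix v assume v: "v \<in> filippov_set F x"
  have "dist v (F x) \<le> r" if "r > 0" for r
  proof -
    obtain \<delta> where "\<delta> > 0" "\<And>y. dist y x < \<delta> \<Longrightarrow> dist (F y) (F x) < r"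
      using assms \<open>r > 0\<close> unfolding continuous_at_eps_delta by blast
    then have "v \<in> cball (F x) r"
      by (intro filippov_set_memD[OF v, of \<delta> "{}"]) (auto simp: dist_commute less_imp_le)
    then show ?thesis by (simp add: dist_commute)
  qed
  then have "dist v (F x) \<le> 0" by (metis field_le_epsilon add_0)
  then show "v \<in> {F x}" by simp
next
  fix v assume "v \<in> {F x}"
  then have v: "v = F x" by simp
  show "v \<in> filippov_set F x"
  proof (rule filippov_set_memI)
    fix \<delta> r :: real and N :: "'a set" assume h: "\<delta> > 0" "negligible N" "r > 0"
    obtain \<eta> where "\<eta> > 0" and \<eta>: "\<And>y. dist y x < \<eta> \<Longrightarrow> dist (F y) (F x) < r"
      using assms h unfolding continuous_at_eps_delta by blast
    have "ball x (min \<delta> \<eta>) \<noteq> {}" using h \<open>\<eta> > 0\<close> by simp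
    from open_minus_negligible[OF open_ball this h(2)]
    obtain y where "y \<in> ball x (min \<delta> \<eta>) - N" by blast
    then show "\<exists>z\<in>convex hull (F ` (ball x \<delta> - N)). dist z v < r"
      using \<eta>[of y] by (intro bexI[of _ "F y"] hull_inc) (auto simp: v dist_commute)
  qed
qed

text \<open>Off the line \<open>x\<^sub>1 = 0\<close> the Filippov inclusion is the differential equation itself, and on
  that line it reads \<open>x\<^sub>1' = - k1 * scaled \<Phi> k3 0 + x\<^sub>2\<close>, \<open>x\<^sub>2' \<in> [w - k2, w + k2]\<close>.\<close>

lemma filippov_set_error_rhs:
  assumes "dgf \<Phi>" "k2 > 0" "k3 > 0"
  shows "filippov_set (error_rhs \<Phi> k1 k2 k3 w) (x1, x2) =
    {- k1 * scaled \<Phi> k3 x1 + x2} \<times>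
      (if x1 = 0 then {w - k2..w + k2}
       else {- 2 * k2 * scaled \<Phi> k3 x1 * deriv (scaled \<Phi> k3) x1 + w})"
proof -
  note D = assms(1)[unfolded dgf_def]
  define d where "d = deriv \<Phi>"
  have cP: "isCont \<Phi> x" for x using D abs_cont_imp_isCont by blast
  have dP: "\<And>x. x \<noteq> 0 \<Longrightarrow> (\<Phi> has_real_derivative d x) (at x)"
    and dd: "\<And>x. x \<noteq> 0 \<Longrightarrow> isCont d x"
    using D C1_punctured_deriv DERIV_isCont unfolding d_def by blast+
  define s where "s = scaled \<Phi> k3"
  have cs: "isCont s x" for x
  proof -
    have "isCont (\<lambda>x. \<Phi> (k3\<^sup>2 * x)) x"
      by (rule isCont_o2[OF _ cP]) (intro continuous_intros)
    then have "isCont (\<lambda>x. \<Phi> (k3\<^sup>2 * x) / k3) x"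
      using assms by (intro continuous_intros) auto
    then show ?thesis by (simp add: s_def scaled_def[abs_def])
  qed
  have ds: "deriv s x = k3 * d (k3\<^sup>2 * x)" if "x \<noteq> 0" for x
  proof (rule DERIV_imp_deriv)
    have "((\<lambda>x. \<Phi> (k3\<^sup>2 * x) / k3) has_real_derivative d (k3\<^sup>2 * x) * k3\<^sup>2 / k3) (at x)"
      using that assms
      by (intro DERIV_cdivide DERIV_chain2[OF dP]) (auto intro!: derivative_eq_intros)
    moreover have "s = (\<lambda>x. \<Phi> (k3\<^sup>2 * x) / k3)" by (simp add: s_def scaled_def[abs_def])
    moreover have "d (k3\<^sup>2 * x) * k3\<^sup>2 / k3 = k3 * d (k3\<^sup>2 * x)"
      using assms by (simp add: power2_eq_square)
    ultimately show "(s has_real_derivative k3 * d (k3\<^sup>2 * x)) (at x)" by simp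
  qed
  define h where "h = (\<lambda>x. s x * deriv s x)"
  have h: "h x = \<Phi> (k3\<^sup>2 * x) * d (k3\<^sup>2 * x)" if "x \<noteq> 0" for x
    using that assms by (simp add: h_def ds) (simp add: s_def scaled_def)
  have ch: "isCont h x" if "x \<noteq> 0" for x
  proof -
    have "isCont (\<lambda>x. \<Phi> (k3\<^sup>2 * x) * d (k3\<^sup>2 * x)) x"
      using that assms
      by (intro continuous_intros isCont_o2[OF _ cP] isCont_o2[OF _ dd]) auto
    moreover have "\<forall>\<^sub>F y in nhds x. h y = \<Phi> (k3\<^sup>2 * y) * d (k3\<^sup>2 * y)"
      using t1_space_nhds[OF that] by eventually_elim (use h in auto)
    ultimately show ?thesis by (simp add: isCont_cong)
  qed
  have dodd: "d (- x) = d x" if "x \<noteq> 0" for x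
  proof -
    have "((\<lambda>x. - \<Phi> (- x)) has_real_derivative d x) (at (-x))"
      using dP[of x] that by (auto intro!: derivative_eq_intros DERIV_chain2[of \<Phi>])
    moreover have "(\<lambda>x. - \<Phi> (- x)) = \<Phi>" using D by auto
    ultimately show ?thesis using dP[of "-x"] that DERIV_unique by auto
  qed
  have hodd: "h (- x) = - h x" for x
  proof (cases "x = 0")
    case True
    have "\<Phi> 0 = 0" using D by (metis minus_zero equal_neg_zero)
    then show ?thesis using True by (simp add: h_def s_def scaled_def)
  next
    case False
    then show ?thesis using D assms dodd[of "k3\<^sup>2 * x"] by (simp add: h)
  qed
  have "filterlim (\<lambda>x. k3\<^sup>2 * x) (at_right 0) (at_right 0)"
    unfolding filterlim_at using assms
    by (auto intro!: tendsto_eq_intros simp: eventually_at_right_field intro: exI[of _ 1])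
  from filterlim_compose[OF dgf_prod_lim[OF assms(1)] this]
  have "((\<lambda>x. \<Phi> (k3\<^sup>2 * x) * d (k3\<^sup>2 * x)) \<longlongrightarrow> 1/2) (at_right 0)" by (simp add: d_def)
  then have hlim: "(h \<longlongrightarrow> 1/2) (at_right 0)"
    by (rule Lim_transform_eventually) (auto simp: eventually_at_right_field h intro!: exI[of _ 1])
  have hr: "\<exists>\<delta>>0. \<forall>y. 0 < \<bar>y\<bar> \<and> \<bar>y\<bar> < \<delta> \<longrightarrow> \<bar>h y - sgn y / 2\<bar> < r" if "r > 0" for r
  proof -
    have "\<forall>\<^sub>F y in at_right 0. dist (h y) (1/2) < r" using hlim that by (rule tendstoD)
    then obtain b where b: "b > 0" "\<And>y. 0 < y \<Longrightarrow> y < b \<Longrightarrow> dist (h y) (1/2) < r"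
      unfolding eventually_at_right_field by auto
    have "\<bar>h y - sgn y / 2\<bar> < r" if "0 < \<bar>y\<bar>" "\<bar>y\<bar> < b" for y
    proof (cases "y > 0")
      case True then show ?thesis using b(2)[of y] that by (simp add: dist_real_def)
    next
      case False
      then have "dist (h (-y)) (1/2) < r" "y < 0" using b(2)[of "-y"] that by auto
      then show ?thesis by (simp add: hodd dist_real_def)
    qed
    with b(1) show ?thesis by auto
  qed
  define F where "F = error_rhs \<Phi> k1 k2 k3 w"
  have F: "F (a, b) = (- k1 * s a + b, - 2 * k2 * h a + w)" for a b
    by (simp add: F_def error_rhs_def s_def h_def mult.assoc)
  have F': "F = (\<lambda>p. (- k1 * s (fst p) + snd p, - 2 * k2 * h (fst p) + w))"
    using F by auto
  have *: "filippov_set F (x1, x2) =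
    {- k1 * s x1 + x2} \<times> (if x1 = 0 then {w - k2..w + k2} else {- 2 * k2 * h x1 + w})"
  proof (cases "x1 = 0")
    case False
    have "isCont F (x1, x2)"
      unfolding F' using False
      by (intro continuous_intros isCont_o2[OF _ cs] isCont_o2[OF _ ch]) auto
    then show ?thesis using False by (simp add: filippov_set_isCont F)
  next
    case True
    have s0: "s 0 = 0" using D by (simp add: s_def scaled_def) (metis minus_zero equal_neg_zero)
    have near: "\<exists>\<delta>>0. \<forall>a b. (a, b) \<in> ball (0, x2) \<delta> \<and> a \<noteq> 0 \<longrightarrow>
        \<bar>- k1 * s a + b - x2\<bar> < r \<and> \<bar>- 2 * k2 * h a + k2 * sgn a\<bar> < r" if "r > 0" for r
    proof -
      have "isCont (\<lambda>p. - k1 * s (fst p) + snd p) (0 :: real, x2)"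
        by (intro continuous_intros isCont_o2[OF _ cs])
      then have "\<exists>\<delta>>0. \<forall>p. dist p (0, x2) < \<delta> \<longrightarrow>
          dist (- k1 * s (fst p) + snd p) (- k1 * s (fst (0 :: real, x2)) + snd (0 :: real, x2)) < r"
        using that unfolding continuous_at_eps_delta by blast
      then obtain \<delta>1 where d1: "\<delta>1 > 0"
        "\<And>p. dist p (0, x2) < \<delta>1 \<Longrightarrow> dist (- k1 * s (fst p) + snd p) x2 < r"
        unfolding fst_conv snd_conv s0 mult_zero_right add_0 by blast
      have "r / (2 * k2) > 0" using that assms by simp
      from hr[OF this] obtain \<delta>2 where d2: "\<delta>2 > 0"
        "\<And>y. 0 < \<bar>y\<bar> \<Longrightarrow> \<bar>y\<bar> < \<delta>2 \<Longrightarrow> \<bar>h y - sgn y / 2\<bar> < r / (2 * k2)"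
        by blast
      show ?thesis
      proof (intro exI[of _ "min \<delta>1 \<delta>2"] conjI allI impI)
        show "min \<delta>1 \<delta>2 > 0" using d1 d2 by simp
        fix a b :: real assume ab: "(a, b) \<in> ball (0, x2) (min \<delta>1 \<delta>2) \<and> a \<noteq> 0"
        then have "dist (a, b) (0, x2) < \<delta>1" by (simp add: dist_commute)
        from d1(2)[OF this] show "\<bar>- k1 * s a + b - x2\<bar> < r" by (simp add: dist_real_def)
        have "dist a 0 \<le> dist (a, b) (0, x2)"
          using dist_fst_le[of "(a, b)" "(0, x2)"] by simp
        then have "\<bar>a\<bar> < \<delta>2" using ab by (simp add: dist_commute)
        then have "\<bar>h a - sgn a / 2\<bar> < r / (2 * k2)" using d2(2)[of a] ab by simp
        then have "2 * k2 * \<bar>h a - sgn a / 2\<bar> < r" using assms by (simp add: field_simps)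
        moreover have "\<bar>- 2 * k2 * h a + k2 * sgn a\<bar> = 2 * k2 * \<bar>h a - sgn a / 2\<bar>"
        proof -
          have "- 2 * k2 * h a + k2 * sgn a = - (2 * k2 * (h a - sgn a / 2))"
            by (simp add: algebra_simps)
          then show ?thesis using assms by (simp add: abs_mult)
        qed
        ultimately show "\<bar>- 2 * k2 * h a + k2 * sgn a\<bar> < r" by simp
      qed
    qed
    have nline: "negligible {p :: real \<times> real. fst p = 0}"
    proof -
      have "negligible {p :: real \<times> real. (1, 0) \<bullet> p = 0}"
        by (rule negligible_hyperplane) (auto simp: zero_prod_def)
      then show ?thesis by (simp add: inner_prod_def)
    qed
    have "filippov_set F (0, x2) = {x2} \<times> {w - k2..w + k2}"
    proof (intro equalityI subsetI)
      fix v assume v: "v \<in> filippov_set F (0, x2)"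
      have "v \<in> {x2 - r..x2 + r} \<times> {w - k2 - r..w + k2 + r}" if r: "r > 0" for r
      proof -
        obtain \<delta> where d: "\<delta> > 0" "\<And>a b. (a, b) \<in> ball (0, x2) \<delta> \<Longrightarrow> a \<noteq> 0 \<Longrightarrow>
          \<bar>- k1 * s a + b - x2\<bar> < r \<and> \<bar>- 2 * k2 * h a + k2 * sgn a\<bar> < r"
          using near[OF r] by auto
        show ?thesis
        proof (rule filippov_set_memD[OF v d(1) nline])
          show "closed ({x2 - r..x2 + r} \<times> {w - k2 - r..w + k2 + r})"
            by (intro closed_Times) auto
          show "convex ({x2 - r..x2 + r} \<times> {w - k2 - r..w + k2 + r})"
            by (intro convex_Times) auto
          fix y :: "real \<times> real" assume y: "y \<in> ball (0, x2) \<delta> - {p. fst p = 0}"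
          obtain a b where ab: "y = (a, b)" by (cases y)
          have "a \<noteq> 0" using y ab by simp
          then have "sgn a = 1 \<or> sgn a = -1" by (auto simp: sgn_if)
          moreover have "\<bar>- k1 * s a + b - x2\<bar> < r \<and> \<bar>- 2 * k2 * h a + k2 * sgn a\<bar> < r"
            using d(2)[of a b] y ab by simp
          ultimately show "F y \<in> {x2 - r..x2 + r} \<times> {w - k2 - r..w + k2 + r}"
            using \<open>k2 > 0\<close> by (auto simp: ab F abs_less_iff)
        qed
      qed
      then have e: "\<And>r. r > 0 \<Longrightarrow> x2 - r \<le> fst v \<and> fst v \<le> x2 + r \<and> w - k2 - r \<le> snd v \<and> snd v \<le> w + k2 + r"
        by (auto simp: mem_Times_iff)
      have "x2 \<le> fst v" "fst v \<le> x2" "w - k2 \<le> snd v" "snd v \<le> w + k2"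
        by (rule field_le_epsilon, use e in \<open>force\<close>)+
      then show "v \<in> {x2} \<times> {w - k2..w + k2}" by (simp add: mem_Times_iff)
    next
      fix v assume v: "v \<in> {x2} \<times> {w - k2..w + k2}"
      define q where "q = snd v - w"
      define \<theta> where "\<theta> = (q + k2) / (2 * k2)"
      have q: "v = (x2, q + w)" "\<bar>q\<bar> \<le> k2" using v by (auto simp: q_def abs_le_iff)
      have \<theta>: "0 \<le> \<theta>" "\<theta> \<le> 1" "q = (1 - \<theta>) * (- k2) + \<theta> * k2"
        using q(2) assms by (auto simp: \<theta>_def field_simps abs_le_iff)
      show "v \<in> filippov_set F (0, x2)"
      proof (rule filippov_set_memI)
        fix \<delta> r :: real and N :: "(real \<times> real) set"
        assume h: "\<delta> > 0" "negligible N" "r > 0"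
        obtain \<eta> where \<eta>: "\<eta> > 0" "\<And>a b. (a, b) \<in> ball (0, x2) \<eta> \<Longrightarrow> a \<noteq> 0 \<Longrightarrow>
            \<bar>- k1 * s a + b - x2\<bar> < r / 2 \<and> \<bar>- 2 * k2 * h a + k2 * sgn a\<bar> < r / 2"
          using near[of "r / 2"] h by auto
        define U where "U = ball (0 :: real, x2) (min \<delta> \<eta>)"
        define \<rho> where "\<rho> = min \<delta> \<eta> / 2"
        have \<rho>: "\<rho> > 0" "\<rho> < min \<delta> \<eta>" using h \<eta> by (auto simp: \<rho>_def)
        have op: "open (U \<inter> {p. fst p > 0})" "open (U \<inter> {p. fst p < 0})"
          unfolding U_def by (intro open_Int open_ball open_Collect_less continuous_intros)+
        have "(\<rho>, x2) \<in> U \<inter> {p. fst p > 0}" "(- \<rho>, x2) \<in> U \<inter> {p. fst p < 0}"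
          using \<rho> by (auto simp: U_def dist_Pair_Pair dist_real_def)
        then obtain y z where y: "y \<in> U \<inter> {p. fst p > 0} - N" and z: "z \<in> U \<inter> {p. fst p < 0} - N"
          using open_minus_negligible[OF op(1) _ h(2)] open_minus_negligible[OF op(2) _ h(2)]
          by (metis empty_iff)
        define Y where "Y = F y"
        define Z where "Z = F z"
        have Y: "\<bar>fst Y - x2\<bar> < r / 2" "\<bar>snd Y - (w - k2)\<bar> < r / 2"
          using \<eta>(2)[of "fst y" "snd y"] y by (auto simp: Y_def F' U_def algebra_simps)
        have Z: "\<bar>fst Z - x2\<bar> < r / 2" "\<bar>snd Z - (w + k2)\<bar> < r / 2"
          using \<eta>(2)[of "fst z" "snd z"] z by (auto simp: Z_def F' U_def algebra_simps)
        define X where "X = (1 - \<theta>) *\<^sub>R Y + \<theta> *\<^sub>R Z"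
        have "X \<in> convex hull (F ` (ball (0, x2) \<delta> - N))"
          unfolding X_def using y z \<theta>
          by (intro convexD_alt convex_convex_hull hull_inc) (auto simp: Y_def Z_def U_def)
        moreover have cmb: "\<bar>(1 - \<theta>) * A + \<theta> * B\<bar> < r / 2" if "\<bar>A\<bar> < r / 2" "\<bar>B\<bar> < r / 2" for A B
        proof -
          have "(1 - \<theta>) *\<^sub>R A + \<theta> *\<^sub>R B \<in> ball 0 (r / 2)"
            using that \<theta> by (intro convexD_alt) auto
          then show ?thesis by simp
        qed
        have "fst X - fst v = (1 - \<theta>) * (fst Y - x2) + \<theta> * (fst Z - x2)"
          by (simp add: X_def q algebra_simps)
        then have f: "\<bar>fst X - fst v\<bar> < r / 2" using cmb Y Z by simp
        have "snd X - snd v = (1 - \<theta>) * (snd Y - (w - k2)) + \<theta> * (snd Z - (w + k2))"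
          by (simp add: X_def q(1) \<theta>(3)) (simp add: algebra_simps)
        then have "\<bar>snd X - snd v\<bar> < r / 2" using cmb Y Z by simp
        with f have "dist X v < r"
        proof -
          have "dist X v = sqrt ((fst X - fst v)\<^sup>2 + (snd X - snd v)\<^sup>2)"
            by (simp add: dist_prod_def dist_real_def)
          also have "\<dots> \<le> \<bar>fst X - fst v\<bar> + \<bar>snd X - snd v\<bar>"
            by (rule sqrt_sum_squares_le_sum_abs)
          finally show ?thesis using f \<open>\<bar>snd X - snd v\<bar> < r / 2\<close> by linarith
        qed
        ultimately show "\<exists>z\<in>convex hull (F ` (ball (0, x2) \<delta> - N)). dist z v < r" by blast
      qed
    qed
    then show ?thesis using True by (simp add: s0)
  qed
  then show ?thesis by (simp add: F_def s_def h_def mult.assoc)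
qed

end

theory Submission
  imports Defs "HOL-Real_Asymp.Real_Asymp"
begin

text \<open>Already the zero signal forces a large convergence time. For \<open>f = 0\<close> and \<open>k1\<^sup>2 \<ge> 8 k2\<close> there are
  trajectories approaching the origin with \<open>x\<^sub>1' = - \<mu> \<Phi>\<^bsub>k3\<^esub>(x\<^sub>1)\<close>, where
  \<open>\<mu> = (k1 - sqrt (k1\<^sup>2 - 8 k2)) / 2\<close>. Separating variables, the time they need from \<open>x\<^sub>1 = X\<close> is
  \<open>1 / (\<mu> k3)\<close> times the integral of \<open>1/\<Phi>\<close> over \<open>[0, k3\<^sup>2 X]\<close>, which tends to \<open>B / (\<mu> k3)\<close> as
  \<open>X \<rightarrow> \<infinity>\<close>; inserting the scaled parameters gives the bound.\<close>

section \<open>Order reversal in \<open>ennreal\<close>, and Lipschitz curves as absolutely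
  continuous ones\<close>

lemma ennreal_inverse_antimono: "x \<le> y \<Longrightarrow> inverse y \<le> inverse x" for x y :: ennreal
  by (simp add: less_eq_ennreal.rep_eq inverse_ennreal.rep_eq ereal_inverse_antimono)

text \<open>Each interval of the division contributes at most \<open>M\<close> times its length, so
  \<open>\<epsilon> / (M + 1)\<close> serves as \<delta>; the summand 1 covers
  \<open>M = 0\<close>.\<close>

lemma lipschitz_imp_local_abs_cont_on:
  fixes g :: "real \<Rightarrow> 'a::real_normed_vector"
  assumes "M-lipschitz_on S g"
  shows "local_abs_cont_on S g"
  unfolding local_abs_cont_on_def abs_cont_on_def
proof (intro allI impI)
  fix a b \<epsilon> :: real
  assume ab: "{a..b} \<subseteq> S" and "\<epsilon> > 0"
  have M: "M \<ge> 0" using assms by (rule lipschitz_on_nonneg)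
  have "(\<Sum>K\<in>\<D>. norm (g (Sup K) - g (Inf K))) < \<epsilon>"
    if \<D>: "\<D> division_of \<Union>\<D> \<and> \<Union>\<D> \<subseteq> {a..b} \<and> (\<Sum>K\<in>\<D>. Sup K - Inf K) < \<epsilon> / (M + 1)" for \<D>
  proof -
    have "norm (g (Sup K) - g (Inf K)) \<le> M * (Sup K - Inf K)" if K: "K \<in> \<D>" for K
    proof -
      obtain u v where uv: "K = cbox u v" "K \<noteq> {}" "K \<subseteq> {a..b}"
        using \<D> K by (metis Union_upper division_ofD(3,4) order_trans)
      then have "u \<le> v" "u \<in> S" "v \<in> S" "Sup K = v" "Inf K = u"
        using ab by auto
      then show ?thesis
        using lipschitz_onD[OF assms, of v u] by (simp add: dist_norm)
    qed
    then have "(\<Sum>K\<in>\<D>. norm (g (Sup K) - g (Inf K))) \<le> M * (\<Sum>K\<in>\<D>. Sup K - Inf K)"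
      by (simp add: sum_distrib_left sum_mono)
    also have "\<dots> \<le> M * (\<epsilon> / (M + 1))"
      using \<D> M by (intro mult_left_mono) auto
    also have "\<dots> < \<epsilon>"
      using M \<open>\<epsilon> > 0\<close> by (simp add: field_simps)
    finally show ?thesis .
  qed
  then show "\<exists>\<delta>>0. \<forall>\<D>. \<D> division_of \<Union>\<D> \<and> \<Union>\<D> \<subseteq> {a..b} \<and> (\<Sum>K\<in>\<D>. Sup K - Inf K) < \<delta>
      \<longrightarrow> (\<Sum>K\<in>\<D>. norm (g (Sup K) - g (Inf K))) < \<epsilon>"
    using M \<open>\<epsilon> > 0\<close> by (intro exI[of _ "\<epsilon> / (M + 1)"]) auto
qed

text \<open>Made for trajectories that come to rest at time \<tau>, with no differentiability
  required at 0 and \<tau>. The mean value theorem gives the bound on \<open>{0..\<tau>}\<close>;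
  replacing \<open>t\<close> by \<open>min t \<tau>\<close>, which does not increase distances,
  extends it to the half-line.\<close>

lemma lipschitz_on_eventually_const:
  fixes g g' :: "real \<Rightarrow> real"
  assumes "continuous_on {0..\<tau>} g" "\<tau> \<ge> 0" "M \<ge> 0"
    and "\<And>t. 0 < t \<Longrightarrow> t < \<tau> \<Longrightarrow> (g has_real_derivative g' t) (at t)"
    and "\<And>t. 0 < t \<Longrightarrow> t < \<tau> \<Longrightarrow> \<bar>g' t\<bar> \<le> M"
    and "\<And>t. t \<ge> \<tau> \<Longrightarrow> g t = g \<tau>"
  shows "M-lipschitz_on {0..} g"
proof -
  have *: "\<bar>g v - g u\<bar> \<le> M * (v - u)" if uv: "0 \<le> u" "u \<le> v" "v \<le> \<tau>" for u v
  proof (cases "u = v")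
    case False
    then have "u < v" using uv by simp
    have "continuous_on {u..v} g"
      using assms(1) uv by (auto intro: continuous_on_subset)
    moreover have "g differentiable (at t)" if "u < t" "t < v" for t
      using assms(4)[of t] that uv by (auto simp: real_differentiable_def)
    ultimately obtain l z where z: "u < z" "z < v" "(g has_real_derivative l) (at z)" "g v - g u = (v - u) * l"
      using MVT[OF \<open>u < v\<close>] by blast
    have "l = g' z" using z uv assms(4)[of z] DERIV_unique by auto
    then show ?thesis
      using z uv assms(5)[of z] by (simp add: abs_mult mult.commute mult_right_mono)
  qed simp
  have cut: "g t = g (min t \<tau>)" for t
    using assms(6)[of t] by (simp add: min_def)
  have **: "\<bar>g v - g u\<bar> \<le> M * (v - u)" if uv: "0 \<le> u" "u \<le> v" for u v
  proof -
    have "\<bar>g v - g u\<bar> \<le> M * (min v \<tau> - min u \<tau>)"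
      using *[of "min u \<tau>" "min v \<tau>"] uv assms(2) cut[of u] cut[of v] by auto
    also have "\<dots> \<le> M * (v - u)"
      using uv assms(3) by (intro mult_left_mono) auto
    finally show ?thesis .
  qed
  show ?thesis
  proof (rule lipschitz_onI)
    fix u v :: real assume "u \<in> {0..}" "v \<in> {0..}"
    then show "dist (g u) (g v) \<le> M * dist u v"
      using **[of u v] **[of v u] by (cases "u \<le> v") (auto simp: dist_real_def abs_minus_commute)
  qed (rule assms)
qed

section \<open>Elementary properties of a DGF\<close>

lemma dgf_zero: "dgf \<Phi> \<Longrightarrow> \<Phi> 0 = 0"
  unfolding dgf_def by (metis minus_zero equal_neg_zero)

lemma dgf_isCont: "dgf \<Phi> \<Longrightarrow> isCont \<Phi> x"
  unfolding dgf_def using abs_cont_imp_isCont by blast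

lemma dgf_DERIV: "dgf \<Phi> \<Longrightarrow> x \<noteq> 0 \<Longrightarrow> (\<Phi> has_real_derivative deriv \<Phi> x) (at x)"
  unfolding dgf_def using C1_punctured_deriv by blast

lemma dgf_pos:
  assumes "dgf \<Phi>" "x > 0"
  shows "\<Phi> x > 0"
proof -
  have "\<Phi> 0 < \<Phi> x"
  proof (rule DERIV_pos_imp_increasing_open[OF assms(2)])
    show "\<exists>y. (\<Phi> has_real_derivative y) (at t) \<and> y > 0" if "0 < t" for t
      using dgf_DERIV[OF assms(1), of t] assms(1) that by (auto simp: dgf_def)
    show "continuous_on {0..x} \<Phi>"
      using dgf_isCont[OF assms(1)] by (simp add: continuous_at_imp_continuous_on)
  qed
  then show ?thesis using dgf_zero[OF assms(1)] by simp
qed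

text \<open>Although \<open>deriv \<Phi>\<close> blows up at 0, the product tends to 1/2 there; on
  the remaining compact interval \<open>{b..Y}\<close> it is continuous.\<close>

lemma dgf_prod_bounded:
  assumes "dgf \<Phi>"
  obtains M where "M \<ge> 0" "\<And>y. 0 < y \<Longrightarrow> y \<le> Y \<Longrightarrow> \<bar>\<Phi> y * deriv \<Phi> y\<bar> \<le> M"
proof -
  have "\<forall>\<^sub>F y in at_right 0. dist (\<Phi> y * deriv \<Phi> y) (1/2) < 1"
    using dgf_prod_lim[OF assms] by (rule tendstoD) simp
  then obtain b where b: "b > 0" "\<And>y. 0 < y \<Longrightarrow> y < b \<Longrightarrow> dist (\<Phi> y * deriv \<Phi> y) (1/2) < 1"
    unfolding eventually_at_right_field by auto
  have "continuous_on (-{0}) (deriv \<Phi>)"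
    using assms C1_punctured_deriv unfolding dgf_def by blast
  then have "continuous_on {b..Y} (\<lambda>y. \<Phi> y * deriv \<Phi> y)"
    using b(1) dgf_isCont[OF assms]
    by (intro continuous_on_mult continuous_at_imp_continuous_on[of _ \<Phi>])
       (auto elim: continuous_on_subset)
  then have "bounded ((\<lambda>y. \<Phi> y * deriv \<Phi> y) ` {b..Y})"
    by (intro compact_imp_bounded compact_continuous_image) auto
  then obtain K where "\<forall>y\<in>{b..Y}. \<bar>\<Phi> y * deriv \<Phi> y\<bar> \<le> K"
    by (auto simp: bounded_iff)
  then have K: "\<bar>\<Phi> y * deriv \<Phi> y\<bar> \<le> K" if "b \<le> y" "y \<le> Y" for y
    using that by auto
  show ?thesis
  proof (rule that[of "max K 2"])
    show "\<bar>\<Phi> y * deriv \<Phi> y\<bar> \<le> max K 2" if "0 < y" "y \<le> Y" for y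
      using b(2)[of y] K[of y] that by (cases "y < b") (auto simp: dist_real_def)
  qed simp
qed

section \<open>The scalar decay equation\<close>

text \<open>The solution is obtained by inverting \<open>y \<mapsto> \<integral>\<^sub>0\<^sup>y 1/\<Phi>\<close>, whose supremum is \<open>B\<close>.\<close>

lemma dgf_decay_solution:
  assumes "dgf \<Phi>" "B > 0" "dgf_integral \<Phi> B = 1" "c > 0" "0 < \<beta>" "\<beta> < B"
  obtains \<tau> y where "\<beta> / c < \<tau>" "continuous_on {0..\<tau>} y"
    "\<And>t. 0 \<le> t \<Longrightarrow> t < \<tau> \<Longrightarrow> 0 < y t" "\<And>t. t \<ge> \<tau> \<Longrightarrow> y t = 0"
    "\<And>t. 0 < t \<Longrightarrow> t < \<tau> \<Longrightarrow> (y has_real_derivative - c * \<Phi> (y t)) (at t)"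
proof -
  \<comment> \<open>Dividing by \<open>B\<close> normalizes the total integral to 1.\<close>
  define f where "f = (\<lambda>x. 1 / (B * \<Phi> x))"
  have \<Phi>m[measurable]: "\<Phi> \<in> borel_measurable borel"
    by (intro borel_measurable_continuous_onI continuous_at_imp_continuous_on ballI dgf_isCont assms)
  have f0: "f x \<ge> 0" if "x \<ge> 0" for x
    using dgf_pos[OF assms(1), of x] dgf_zero[OF assms(1)] that assms(2)
    by (cases "x = 0") (auto simp: f_def)
  have fpos: "f x > 0" if "x > 0" for x
    using dgf_pos[OF assms(1) that] assms(2) by (simp add: f_def)
  \<comment> \<open>Closed and open half-line give the same integrand: at 0 the denominator
    vanishes, and division by zero yields \<open>f 0 = 0\<close>.\<close>
  have "(\<integral>\<^sup>+x. ennreal (indicator {0..} x *\<^sub>R f x) \<partial>lborel) = dgf_integral \<Phi> B"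
    unfolding dgf_integral_def
    by (intro nn_integral_cong)
       (auto simp: f_def indicator_def dgf_zero[OF assms(1)] less_eq_real_def)
  then have "has_bochner_integral lborel (\<lambda>x. indicator {0..} x *\<^sub>R f x) 1"
    by (intro has_bochner_integral_nn_integral) (auto simp: assms(3) f0 f_def[symmetric] indicator_def
          intro!: borel_measurable_scaleR, simp add: f_def)
  then have si: "set_integrable lborel {0..} f" and sv: "set_lebesgue_integral lborel {0..} f = 1"
    by (auto simp: set_integrable_def set_lebesgue_integral_def has_bochner_integral_iff)
  define F where "F = (\<lambda>y. integral {0..y} f)"
  have si': "set_integrable lborel {0..y} f" for y
    by (rule set_integrable_subset[OF si]) auto
  have int: "f integrable_on {0..y}" for y
    using set_borel_integral_eq_integral(1)[OF si'] .
  have "((\<lambda>y. set_lebesgue_integral lborel {0..y} f) \<longlongrightarrow> 1) at_top"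
    using tendsto_set_lebesgue_integral_at_top[OF _ si] sv by simp
  then have "(F \<longlongrightarrow> 1) at_top"
    unfolding F_def set_borel_integral_eq_integral(2)[OF si'] .
  moreover have "\<beta> / B < 1" using assms by simp
  ultimately have "\<forall>\<^sub>F y in at_top. \<beta> / B < F y" by (rule order_tendstoD)
  then have "\<forall>\<^sub>F y in at_top. \<beta> / B < F y \<and> 0 < y"
    using eventually_gt_at_top[of "0::real"] by eventually_elim simp
  \<comment> \<open>\<open>Y\<close> becomes the initial value of the solution. Since
    \<open>F\<close> tends to 1 and \<open>\<beta> / B < 1\<close>, it can be taken so large that
    the descent from it lasts longer than \<open>\<beta> / c\<close>.\<close>
  then obtain Y where Y: "\<beta> / B < F Y" "Y > 0"
    using eventually_happens'[of "at_top :: real filter"] by auto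
  have F0: "F 0 = 0" by (simp add: F_def)
  have cF: "continuous_on {0..Y} F"
    unfolding F_def by (rule indefinite_integral_continuous_1[OF int])
  \<comment> \<open>The point 0 is excluded because the integrand is unbounded near it; continuity
    of \<open>F\<close> at 0 comes from integrability alone.\<close>
  have dF: "(F has_real_derivative f y) (at y)" if "y > 0" for y
  proof -
    have "isCont f y"
      unfolding f_def using dgf_isCont[OF assms(1)] dgf_pos[OF assms(1) that] assms(2)
      by (intro continuous_intros) auto
    then have "(F has_real_derivative f y) (at y within {0..y+1} - {})"
      unfolding F_def has_real_derivative_iff_has_vector_derivative using that
      by (intro integral_has_vector_derivative_continuous_at[OF int])
         (auto intro: continuous_at_imp_continuous_within)
    then show ?thesis
      using that at_within_Icc_at[of 0 y "y + 1"] by simp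
  qed
  have mono: "F u < F v" if "0 \<le> u" "u < v" "v \<le> Y" for u v
  proof (rule DERIV_pos_imp_increasing_open[OF that(2)])
    show "\<exists>z. (F has_real_derivative z) (at x) \<and> z > 0" if "u < x" for x
      using dF[of x] fpos[of x] that \<open>0 \<le> u\<close> by auto
    show "continuous_on {u..v} F"
      using that by (auto intro: continuous_on_subset[OF cF])
  qed
  have inj: "inj_on F {0..Y}"
    by (rule inj_onI) (metis atLeastAtMost_iff linorder_neqE_linordered_idom mono less_irrefl)
  \<comment> \<open>By the inverse function rule \<open>G' = 1 / f G = B * \<Phi> G\<close>, which
    is the decay equation with time reversed, up to a constant factor.\<close>
  define G where "G = the_inv_into {0..Y} F"
  have GF: "G (F y) = y" if "y \<in> {0..Y}" for y
    unfolding G_def using the_inv_into_f_f[OF inj that] .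
  have im: "F ` {0..Y} = {0..F Y}"
  proof (intro equalityI subsetI)
    fix z assume "z \<in> F ` {0..Y}"
    then obtain y where y: "z = F y" "0 \<le> y" "y \<le> Y" by auto
    then show "z \<in> {0..F Y}"
      using mono[of 0 y] mono[of y Y] F0 by (cases "y = 0"; cases "y = Y") (auto simp: less_imp_le)
  next
    fix z assume "z \<in> {0..F Y}"
    then have "\<exists>y\<ge>0. y \<le> Y \<and> F y = z"
      using F0 Y cF by (intro IVT') auto
    then show "z \<in> F ` {0..Y}" by auto
  qed
  have G: "G z \<in> {0..Y}" "F (G z) = z" if "z \<in> {0..F Y}" for z
    using that GF unfolding im[symmetric] by auto
  have cG: "continuous_on {0..F Y} G"
    using continuous_on_inv[OF cF compact_Icc] GF im by auto
  have Gpos: "G z > 0" if "0 < z" "z \<le> F Y" for z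
    using G[of z] that F0 by (cases "G z = 0") auto
  have dG: "(G has_real_derivative B * \<Phi> (G z)) (at z)" if "0 < z" "z < F Y" for z
  proof -
    have "(G has_real_derivative inverse (f (G z))) (at z)"
    proof (rule DERIV_inverse_function[where f = F and a = 0 and b = "F Y"])
      show "(F has_real_derivative f (G z)) (at (G z))" using dF Gpos that by simp
      show "f (G z) \<noteq> 0" using fpos[OF Gpos[of z]] that by simp
      show "isCont G z"
        using continuous_on_interior[OF cG] that by simp
    qed (use that G in auto)
    then show ?thesis by (simp add: f_def)
  qed
  \<comment> \<open>The solution is \<open>G (a * (\<tau> - t))\<close>: the factor \<open>a\<close>
    turns the rate \<open>B\<close> into \<open>c\<close>, and \<open>a * \<tau> = F Y\<close> makes
    it start at \<open>Y\<close> and reach 0 exactly at \<tau>.\<close>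
  define a where "a = c / B"
  define \<tau> where "\<tau> = F Y / a"
  have a: "a > 0" "a * \<tau> = F Y" using assms by (auto simp: a_def \<tau>_def)
  have "F Y > 0" using mono[of 0 Y] F0 Y by simp
  then have \<tau>: "\<tau> > 0" using a by (simp add: \<tau>_def)
  define y where "y = (\<lambda>t. if t < \<tau> then G (a * (\<tau> - t)) else 0)"
  have G0: "G 0 = 0" using GF[of 0] F0 Y by simp
  have yG: "y t = G (a * (\<tau> - t))" if "t \<le> \<tau>" for t
    using that G0 by (simp add: y_def)
  have rng: "0 \<le> a * (\<tau> - t)" "a * (\<tau> - t) \<le> F Y" if "0 \<le> t" "t \<le> \<tau>" for t
    using that a mult_left_mono[of "\<tau> - t" \<tau> a] by auto
  show ?thesis
  proof (rule that[of \<tau> y])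
    show "\<beta> / c < \<tau>"
      using Y assms by (simp add: \<tau>_def a_def field_simps)
    have "continuous_on {0..\<tau>} (\<lambda>t. G (a * (\<tau> - t)))"
      by (rule continuous_on_compose2[OF cG]) (auto intro!: continuous_intros rng)
    then show "continuous_on {0..\<tau>} y"
      by (rule continuous_on_cong[THEN iffD2, rotated 2]) (auto simp: yG)
    show "0 < y t" if "0 \<le> t" "t < \<tau>" for t
      using Gpos[of "a * (\<tau> - t)"] rng[of t] a that by (simp add: yG)
    show "y t = 0" if "t \<ge> \<tau>" for t
      using that by (simp add: y_def)
    show "(y has_real_derivative - c * \<Phi> (y t)) (at t)" if t: "0 < t" "t < \<tau>" for t
    proof -
      have "a * (\<tau> - t) < F Y" using mult_strict_left_mono[of "\<tau> - t" \<tau> a] a t by simp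
      then have "((\<lambda>t. G (a * (\<tau> - t))) has_real_derivative B * \<Phi> (G (a * (\<tau> - t))) * (- a)) (at t)"
        using a t by (intro DERIV_chain2[OF dG]) (auto intro!: derivative_eq_intros)
      also have "B * \<Phi> (G (a * (\<tau> - t))) * (- a) = - c * \<Phi> (y t)"
        using assms t by (simp add: yG a_def)
      finally show ?thesis
        by (rule has_field_derivative_transform_within_open[where S = "{..<\<tau>}"])
           (use t in \<open>auto simp: yG\<close>)
    qed
  qed
qed

section \<open>Slow trajectories of the unperturbed error system\<close>

lemma scaled_deriv:
  assumes "dgf \<Phi>" "k > 0" "x \<noteq> 0"
  shows "(scaled \<Phi> k has_real_derivative k * deriv \<Phi> (k\<^sup>2 * x)) (at x)"
proof -
  have "((\<lambda>x. \<Phi> (k\<^sup>2 * x) / k) has_real_derivative deriv \<Phi> (k\<^sup>2 * x) * k\<^sup>2 / k) (at x)"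
    using assms by (intro DERIV_cdivide DERIV_chain2[OF dgf_DERIV]) (auto intro!: derivative_eq_intros)
  then show ?thesis
    using assms(2) by (simp add: scaled_def[abs_def] power2_eq_square mult.commute)
qed

text \<open>The curve \<open>x\<^sub>2 = \<nu> \<Phi>\<^bsub>k3\<^esub>(x\<^sub>1)\<close> is invariant for the unperturbed system exactly when
  \<open>\<nu> (k1 - \<nu>) = 2 k2\<close>; on it \<open>x\<^sub>1' = - \<mu> \<Phi>\<^bsub>k3\<^esub>(x\<^sub>1)\<close> with \<open>\<mu> = k1 - \<nu>\<close>.\<close>

lemma slow_error_solution:
  assumes "dgf \<Phi>" "B > 0" "dgf_integral \<Phi> B = 1"
    and "k2 > 0" "k3 > 0" "\<mu> > 0" "\<mu> + \<nu> = k1" "\<mu> * \<nu> = 2 * k2" "0 < \<beta>" "\<beta> < B"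
  obtains \<tau> x where "\<beta> / (\<mu> * k3) < \<tau>" "error_solution \<Phi> k1 k2 k3 (\<lambda>_. 0) x"
    "\<And>t. 0 \<le> t \<Longrightarrow> t < \<tau> \<Longrightarrow> x t \<noteq> 0"
proof -
  \<comment> \<open>With \<open>x1 = y / k3\<^sup>2\<close> the scaled function takes the value
    \<open>\<Phi> y / k3\<close>, so decay of \<open>x1\<close> at rate \<mu> under the scaled
    function becomes \<open>y' = - \<mu> * k3 * \<Phi> y\<close>.\<close>
  define c where "c = \<mu> * k3"
  have c: "c > 0" using assms by (simp add: c_def)
  obtain \<tau> y where \<tau>: "\<beta> / c < \<tau>" and cy: "continuous_on {0..\<tau>} y"
    and ypos: "\<And>t. 0 \<le> t \<Longrightarrow> t < \<tau> \<Longrightarrow> 0 < y t" and y0: "\<And>t. t \<ge> \<tau> \<Longrightarrow> y t = 0"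
    and dy: "\<And>t. 0 < t \<Longrightarrow> t < \<tau> \<Longrightarrow> (y has_real_derivative - c * \<Phi> (y t)) (at t)"
    using dgf_decay_solution[OF assms(1-3) c assms(9,10)] by blast
  have \<tau>0: "\<tau> > 0" using \<tau> c assms by (meson divide_pos_pos less_trans)
  define x1 where "x1 = (\<lambda>t. y t / k3\<^sup>2)"
  define x2 where "x2 = (\<lambda>t. \<nu> * \<Phi> (y t) / k3)"
  define x where "x = (\<lambda>t. (x1 t, x2 t))"
  have ky: "k3\<^sup>2 * x1 t = y t" for t using assms by (simp add: x1_def)
  have sx: "scaled \<Phi> k3 (x1 t) = \<Phi> (y t) / k3" for t
    by (simp add: scaled_def ky)
  have dx1: "(x1 has_real_derivative - k1 * scaled \<Phi> k3 (x1 t) + x2 t) (at t)" if "0 < t" "t < \<tau>" for t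
  proof -
    have "(x1 has_real_derivative - c * \<Phi> (y t) / k3\<^sup>2) (at t)"
      unfolding x1_def by (rule DERIV_cdivide[OF dy[OF that]])
    also have "- c * \<Phi> (y t) / k3\<^sup>2 = - k1 * scaled \<Phi> k3 (x1 t) + x2 t"
      using assms(5) by (simp add: sx x2_def c_def assms(7)[symmetric] field_simps power2_eq_square)
    finally show ?thesis .
  qed
  have dx2: "(x2 has_real_derivative - 2 * k2 * (\<Phi> (y t) * deriv \<Phi> (y t))) (at t)" if "0 < t" "t < \<tau>" for t
  proof -
    have "(x2 has_real_derivative \<nu> * (deriv \<Phi> (y t) * (- c * \<Phi> (y t))) / k3) (at t)"
      unfolding x2_def using ypos[of t] that
      by (intro DERIV_cdivide DERIV_cmult DERIV_chain2[OF dgf_DERIV[OF assms(1)]] dy) auto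
    also have "\<nu> * (deriv \<Phi> (y t) * (- c * \<Phi> (y t))) / k3 = - (\<mu> * \<nu>) * (\<Phi> (y t) * deriv \<Phi> (y t))"
      using assms(5) by (simp add: c_def)
    finally show ?thesis by (simp add: assms(8))
  qed
  have "continuous_on {0..\<tau>} (\<lambda>t. \<Phi> (y t))"
    using dgf_isCont[OF assms(1)]
    by (intro continuous_on_compose2[OF _ cy, of UNIV] continuous_at_imp_continuous_on) auto
  then have cx: "continuous_on {0..\<tau>} x1" "continuous_on {0..\<tau>} x2"
    and cv: "continuous_on {0..\<tau>} (\<lambda>t. - k1 * scaled \<Phi> k3 (x1 t) + x2 t)"
    unfolding sx unfolding x1_def x2_def using assms(5) by (auto intro!: continuous_intros cy)
  have bnd: "\<exists>M\<ge>0. \<forall>t\<in>{0..\<tau>}. \<bar>h t\<bar> \<le> M" if "continuous_on {0..\<tau>} h" for h :: "real \<Rightarrow> real"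
  proof -
    have "bounded (h ` {0..\<tau>})"
      using that by (intro compact_imp_bounded compact_continuous_image) auto
    then obtain M where "M > 0" "\<forall>t\<in>{0..\<tau>}. \<bar>h t\<bar> \<le> M"
      by (auto simp: bounded_pos)
    then show ?thesis by (intro exI[of _ M]) auto
  qed
  obtain M1 where M1: "M1 \<ge> 0" "\<And>t. t \<in> {0..\<tau>} \<Longrightarrow> \<bar>- k1 * scaled \<Phi> k3 (x1 t) + x2 t\<bar> \<le> M1"
    using bnd[OF cv] by blast
  obtain Y where Y: "\<And>t. t \<in> {0..\<tau>} \<Longrightarrow> \<bar>y t\<bar> \<le> Y"
    using bnd[OF cy] by blast
  \<comment> \<open>Continuity of \<open>y\<close> does not bound the derivative of
    \<open>x2\<close>, since \<open>deriv \<Phi>\<close> is unbounded near 0; the product bound on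
    \<open>0 < y \<le> Y\<close> does.\<close>
  obtain M2 where M2: "M2 \<ge> 0" "\<And>y. 0 < y \<Longrightarrow> y \<le> Y \<Longrightarrow> \<bar>\<Phi> y * deriv \<Phi> y\<bar> \<le> M2"
    using dgf_prod_bounded[OF assms(1), where Y = Y] by blast
  have x0: "x1 t = 0" "x2 t = 0" if "t \<ge> \<tau>" for t
    using y0[OF that] dgf_zero[OF assms(1)] by (auto simp: x1_def x2_def)
  have "M1-lipschitz_on {0..} x1"
    by (rule lipschitz_on_eventually_const[OF cx(1) _ M1(1) dx1 M1(2)]) (use \<tau>0 x0 in auto)
  moreover have "(2 * k2 * M2)-lipschitz_on {0..} x2"
  proof (rule lipschitz_on_eventually_const[OF cx(2) _ _ dx2])
    show "\<bar>- 2 * k2 * (\<Phi> (y t) * deriv \<Phi> (y t))\<bar> \<le> 2 * k2 * M2" if "0 < t" "t < \<tau>" for t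
    proof -
      have "\<bar>\<Phi> (y t) * deriv \<Phi> (y t)\<bar> \<le> M2"
        using that ypos[of t] Y[of t] by (intro M2) auto
      then have "2 * k2 * \<bar>\<Phi> (y t) * deriv \<Phi> (y t)\<bar> \<le> 2 * k2 * M2"
        using assms(4) by (intro mult_left_mono) auto
      then show ?thesis using assms(4) by (simp add: abs_mult)
    qed
  qed (use \<tau>0 x0 assms(4) M2 in auto)
  ultimately have "local_abs_cont_on {0..} x"
    unfolding x_def by (rule lipschitz_imp_local_abs_cont_on[OF lipschitz_on_Pair])
  moreover have "AE t in lebesgue. 0 \<le> t \<longrightarrow> (\<exists>v. (x has_vector_derivative v) (at t) \<and>
      v \<in> filippov_set (error_rhs \<Phi> k1 k2 k3 0) (x t))"
  proof -
    \<comment> \<open>Two exceptional times: at 0 a two-sided derivative would involve the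
      unspecified values at negative times, and at \<tau> the curve meets the resting phase.\<close>
    have "{0, \<tau>} \<in> null_sets lebesgue"
      by (simp add: negligible_iff_null_sets[symmetric])
    moreover have "\<exists>v. (x has_vector_derivative v) (at t) \<and>
        v \<in> filippov_set (error_rhs \<Phi> k1 k2 k3 0) (x t)" if t: "0 \<le> t" "t \<notin> {0, \<tau>}" for t
    proof (cases "t < \<tau>")
      case True
      then have t': "0 < t" "t < \<tau>" using t by auto
      have n: "x1 t \<noteq> 0" using ypos[of t] t' assms(5) by (simp add: x1_def)
      define v where "v = (- k1 * scaled \<Phi> k3 (x1 t) + x2 t, - 2 * k2 * (\<Phi> (y t) * deriv \<Phi> (y t)))"
      have "(x has_vector_derivative v) (at t)"
        unfolding x_def v_def using dx1[OF t'] dx2[OF t']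
        by (intro has_vector_derivative_Pair) (auto simp: has_real_derivative_iff_has_vector_derivative)
      moreover have "deriv (scaled \<Phi> k3) (x1 t) = k3 * deriv \<Phi> (y t)"
        using DERIV_imp_deriv[OF scaled_deriv[OF assms(1,5) n]] by (simp add: ky)
      \<comment> \<open>Off the line \<open>x1 = 0\<close> the inclusion is an equation, and the
        factors \<open>1 / k3\<close> and \<open>k3\<close> of the scaled function and its
        derivative cancel.\<close>
      then have "v \<in> filippov_set (error_rhs \<Phi> k1 k2 k3 0) (x t)"
        using n assms(5)
        by (simp add: x_def v_def filippov_set_error_rhs[OF assms(1,4,5)] sx)
      ultimately show ?thesis by blast
    next
      case False
      then have t': "\<tau> < t" using t by auto
      have "(x has_vector_derivative 0) (at t)"
        by (rule has_vector_derivative_transform_within_open[of "\<lambda>_. 0" _ _ "{\<tau><..}"])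
           (use t' x0 in \<open>auto simp: x_def simp flip: zero_prod_def\<close>)
      \<comment> \<open>Resting at the origin is allowed because 0 lies in
        \<open>{- k2..k2}\<close>.\<close>
      moreover have "0 \<in> filippov_set (error_rhs \<Phi> k1 k2 k3 0) (x t)"
        using t' x0[of t] assms(4) dgf_zero[OF assms(1)]
        by (simp add: x_def filippov_set_error_rhs[OF assms(1,4,5)] scaled_def zero_prod_def)
      ultimately show ?thesis by blast
    qed
    ultimately show ?thesis
      by (intro AE_I'[of "{0, \<tau>}"]) blast+
  qed
  ultimately have "error_solution \<Phi> k1 k2 k3 (\<lambda>_. 0) x"
    by (simp add: error_solution_def filippov_solution_def)
  moreover have "x t \<noteq> 0" if "0 \<le> t" "t < \<tau>" for t
    using ypos[OF that] assms(5) by (simp add: x_def x1_def zero_prod_def)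
  ultimately show ?thesis using that \<tau> unfolding c_def by blast
qed

section \<open>Lower bound for the global convergence time\<close>

text \<open>The zero signal satisfies every bound \<open>L \<ge> 0\<close>, so the slow trajectories
  compete in the supremum. Each value below \<open>B / (\<mu> * k3)\<close> is exceeded by the
  convergence time of one of them, and density of the order gives the bound itself.\<close>

lemma global_conv_time_ge:
  assumes "dgf \<Phi>" "B > 0" "dgf_integral \<Phi> B = 1" "L \<ge> 0"
    and "k2 > 0" "k3 > 0" "\<mu> > 0" "\<mu> + \<nu> = k1" "\<mu> * \<nu> = 2 * k2"
  shows "ennreal (B / (\<mu> * k3)) \<le> global_conv_time \<Phi> k1 k2 k3 L"
proof (rule dense_le)
  fix z assume z: "z < ennreal (B / (\<mu> * k3))"
  have p: "\<mu> * k3 > 0" using assms by simp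
  obtain r where r: "z = ennreal r" "r \<ge> 0"
    using z by (cases z) auto
  show "z \<le> global_conv_time \<Phi> k1 k2 k3 L"
  proof (cases "r = 0")
    case False
    \<comment> \<open>Chosen so that the guaranteed duration \<open>\<beta> / (\<mu> * k3)\<close>
      is \<open>r\<close>; the case \<open>r = 0\<close> is separate since \<beta> must be
      positive.\<close>
    define \<beta> where "\<beta> = r * (\<mu> * k3)"
    have "r < B / (\<mu> * k3)" using z r by (simp add: ennreal_less_iff)
    then have \<beta>: "0 < \<beta>" "\<beta> < B" "\<beta> / (\<mu> * k3) = r"
      using False r p by (auto simp: \<beta>_def pos_less_divide_eq)
    obtain \<tau> x where x: "r < \<tau>" "error_solution \<Phi> k1 k2 k3 (\<lambda>_. 0) x"
        "\<And>t. 0 \<le> t \<Longrightarrow> t < \<tau> \<Longrightarrow> x t \<noteq> 0"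
      using slow_error_solution[OF assms(1-3,5-9) \<beta>(1,2)] unfolding \<beta>(3) by blast
    have "signal L (\<lambda>_. 0)"
      unfolding signal_def using assms(4)
      by (auto intro!: exI[of _ "\<lambda>_. 0"] exI[of _ 0] lipschitz_on_constant)
    then have "(\<lambda>_. 0, x) \<in> {(f, x'). signal L f \<and> error_solution \<Phi> k1 k2 k3 f x' \<and> x' 0 = x 0}"
      using x(2) by simp
    then have "conv_time x \<le> conv_time_fun \<Phi> k1 k2 k3 L (x 0)"
      unfolding conv_time_fun_def by (rule SUP_upper2) simp
    also have "\<dots> \<le> global_conv_time \<Phi> k1 k2 k3 L"
      unfolding global_conv_time_def by (rule SUP_upper) simp
    finally have "conv_time x \<le> global_conv_time \<Phi> k1 k2 k3 L" .
    moreover have "z \<le> conv_time x"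
      unfolding conv_time_def
    proof (rule INF_greatest)
      fix t assume "t \<in> {t. 0 \<le> t \<and> (\<forall>\<sigma>\<ge>t. x \<sigma> = 0)}"
      then have "\<not> t < \<tau>" using x(3)[of t] by auto
      then show "z \<le> ennreal t" using x(1) r by (simp add: ennreal_leI)
    qed
    ultimately show ?thesis by (rule order_trans[rotated])
  qed (simp add: r)
qed

section \<open>Asymptotics of the bound\<close>

text \<open>The factor \<open>\<kappa> - sqrt (\<kappa>\<^sup>2 - 8 * a)\<close> behaves like
  \<open>4 * a / \<kappa>\<close>. It sends the logarithmic term with \<open>C\<close> to 0, while
  the \<open>B\<close> term grows like \<open>\<kappa> / (4 * a)\<close> after division by
  \<open>2 * B\<close>, so that product tends to 1.\<close>

lemma T_tilde_bound_tendsto: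
  assumes "a > 0" "k3 > 0" "B > 0"
  shows "((\<lambda>\<kappa>. (\<kappa> - sqrt (\<kappa>\<^sup>2 - 8 * a)) * k3 * T_tilde B C \<kappa> a k3 / (2 * B)) \<longlongrightarrow> 1) at_top"
proof -
  define s where "s = (\<lambda>\<kappa>. sqrt (\<kappa>\<^sup>2 - 8 * a))"
  have 1: "((\<lambda>\<kappa>. (\<kappa> - s \<kappa>) * (ln ((\<kappa> + s \<kappa>) / (\<kappa> - s \<kappa>)) / (2 * s \<kappa>))) \<longlongrightarrow> 0) at_top"
    unfolding s_def using assms(1) by real_asymp
  have 2: "((\<lambda>\<kappa>. (\<kappa> - s \<kappa>) * ((\<kappa>\<^sup>2 + 4 * a) / (4 * \<kappa> * a))) \<longlongrightarrow> 1) at_top"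
    unfolding s_def using assms(1) by real_asymp
  have "((\<lambda>\<kappa>. (\<kappa> - s \<kappa>) * (ln ((\<kappa> + s \<kappa>) / (\<kappa> - s \<kappa>)) / (2 * s \<kappa>)) * (C / (2 * B))
      + (\<kappa> - s \<kappa>) * ((\<kappa>\<^sup>2 + 4 * a) / (4 * \<kappa> * a))) \<longlongrightarrow> 0 * (C / (2 * B)) + 1) at_top"
    by (intro tendsto_intros 1 2)
  moreover have "\<forall>\<^sub>F \<kappa> in at_top. \<kappa>\<^sup>2 > 8 * a"
    by real_asymp
  then have "\<forall>\<^sub>F \<kappa> in at_top. (\<kappa> - s \<kappa>) * (ln ((\<kappa> + s \<kappa>) / (\<kappa> - s \<kappa>)) / (2 * s \<kappa>)) * (C / (2 * B))
      + (\<kappa> - s \<kappa>) * ((\<kappa>\<^sup>2 + 4 * a) / (4 * \<kappa> * a))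
      = (\<kappa> - s \<kappa>) * k3 * T_tilde B C \<kappa> a k3 / (2 * B)"
    using eventually_gt_at_top[of 0]
  proof eventually_elim
    case (elim \<kappa>)
    then have s: "s \<kappa> > 0" by (simp add: s_def)
    \<comment> \<open>The logarithm is made an atom so that \<open>field_simps\<close> leaves its
      argument alone.\<close>
    obtain l where l: "ln ((\<kappa> + s \<kappa>) / (\<kappa> - s \<kappa>)) = l" by blast
    have T: "T_tilde B C \<kappa> a k3 = ln ((\<kappa> + s \<kappa>) / (\<kappa> - s \<kappa>)) / (2 * k3 * s \<kappa>) * C
        + (\<kappa>\<^sup>2 + 4 * a) / (2 * \<kappa> * a * k3) * B"
      using elim by (simp add: T_tilde_def s_def)
    show ?case
      unfolding T l using elim assms s by (simp add: field_simps)
  qed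
  ultimately have "((\<lambda>\<kappa>. (\<kappa> - s \<kappa>) * k3 * T_tilde B C \<kappa> a k3 / (2 * B))
      \<longlongrightarrow> 0 * (C / (2 * B)) + 1) at_top"
    by (rule Lim_transform_eventually)
  then show ?thesis by (simp add: s_def)
qed

section \<open>Substitution of the scaled parameters\<close>

theorem theorem4p11:
  fixes \<Phi> :: "real \<Rightarrow> real" and T \<gamma> L B kt1 kt2 kt3 :: real
  assumes "T > 0" and "L \<ge> 0" and "\<gamma> > L"
    and "admissible_dgf \<Phi>"
    and "B > 0" and "dgf_integral \<Phi> B = 1"
    and "normalized_params \<Phi> kt1 kt2 kt3"
    and "kt1\<^sup>2 \<ge> 8 * kt2"
  shows
    "(\<forall>Tt k1 k2 k3.
        Tt > 0 \<and> global_conv_time \<Phi> kt1 kt2 kt3 0 \<le> ennreal Tt \<and>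
        k1 = kt1 * sqrt \<gamma> \<and> k2 = kt2 * \<gamma> \<and> k3 = kt3 * sqrt \<gamma> / (\<gamma> - L) * (Tt / T)
        \<longrightarrow> ennreal T / global_conv_time \<Phi> k1 k2 k3 L
              \<le> ennreal ((kt1 - sqrt (kt1\<^sup>2 - 8 * kt2)) * kt3 * Tt / (2 * B) * (\<gamma> / (\<gamma> - L))))
     \<and>
     (\<forall>C. dgf_slope_const \<Phi> C \<longrightarrow>
        ((\<lambda>\<kappa>. (\<kappa> - sqrt (\<kappa>\<^sup>2 - 8 * kt2)) * kt3 * T_tilde B C \<kappa> kt2 kt3 / (2 * B) * (\<gamma> / (\<gamma> - L)))
           \<longlongrightarrow> \<gamma> / (\<gamma> - L)) at_top)"
proof (intro conjI allI impI)
  have \<Phi>: "dgf \<Phi>" using assms by (simp add: admissible_dgf_def)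
  have k: "kt1 > 0" "kt2 > 0" "kt3 > 0" using assms by (auto simp: normalized_params_def)
  have \<gamma>: "\<gamma> > 0" using assms by simp
  define s where "s = sqrt (kt1\<^sup>2 - 8 * kt2)"
  have s2: "s\<^sup>2 = kt1\<^sup>2 - 8 * kt2" using assms by (simp add: s_def)
  have "s < kt1" using k by (simp add: s_def real_less_lsqrt)
  fix Tt k1 k2 k3
  assume H: "Tt > 0 \<and> global_conv_time \<Phi> kt1 kt2 kt3 0 \<le> ennreal Tt \<and>
        k1 = kt1 * sqrt \<gamma> \<and> k2 = kt2 * \<gamma> \<and> k3 = kt3 * sqrt \<gamma> / (\<gamma> - L) * (Tt / T)"
  \<comment> \<open>The two roots of \<open>z\<^sup>2 - k1 * z + 2 * k2\<close>, real because
    \<open>kt1\<^sup>2 \<ge> 8 * kt2\<close>. The smaller one is the decay rate, as it gives the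
    longer convergence time.\<close>
  define \<mu> where "\<mu> = sqrt \<gamma> * (kt1 - s) / 2"
  define \<nu> where "\<nu> = sqrt \<gamma> * (kt1 + s) / 2"
  have \<mu>: "\<mu> > 0" using \<open>s < kt1\<close> \<gamma> by (simp add: \<mu>_def)
  have k3_eq: "k3 = kt3 * sqrt \<gamma> / (\<gamma> - L) * (Tt / T)" using H by simp
  have k3: "k3 > 0" using H k \<gamma> assms by simp
  have "\<mu> * \<nu> = (sqrt \<gamma>)\<^sup>2 * (kt1\<^sup>2 - s\<^sup>2) / 4"
    by (simp add: \<mu>_def \<nu>_def power2_eq_square algebra_simps)
  then have "\<mu> * \<nu> = 2 * k2" using \<gamma> H by (simp add: s2)
  moreover have "\<mu> + \<nu> = k1" using H by (simp add: \<mu>_def \<nu>_def field_simps)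
  ultimately have ge: "ennreal (B / (\<mu> * k3)) \<le> global_conv_time \<Phi> k1 k2 k3 L"
    using global_conv_time_ge[OF \<Phi> assms(5,6,2) _ k3 \<mu>] H k \<gamma> by simp
  have p: "B / (\<mu> * k3) > 0" using assms \<mu> k3 by simp
  \<comment> \<open>This also covers an infinite convergence time, whose inverse is 0.\<close>
  have "ennreal T / global_conv_time \<Phi> k1 k2 k3 L \<le> ennreal T / ennreal (B / (\<mu> * k3))"
    unfolding divide_ennreal_def
    by (intro mult_left_mono ennreal_inverse_antimono[OF ge]) simp
  also have "\<dots> = ennreal (T / (B / (\<mu> * k3)))"
    using assms p by (simp add: divide_ennreal)
  \<comment> \<open>\<open>T\<close> cancels against the \<open>1 / T\<close> in \<open>k3\<close>;
    \<mu> and \<open>k3\<close> each supply one factor \<open>sqrt \<gamma>\<close>.\<close>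
  also have "T / (B / (\<mu> * k3)) = (kt1 - s) * kt3 * Tt / (2 * B) * ((sqrt \<gamma>)\<^sup>2 / (\<gamma> - L))"
  proof -
    obtain r d where r: "sqrt \<gamma> = r" and d: "\<gamma> - L = d" "d \<noteq> 0" using assms by auto
    show ?thesis
      using assms(1,5) d(2) unfolding \<mu>_def k3_eq r d(1) by (simp add: field_simps power2_eq_square)
  qed
  finally show "ennreal T / global_conv_time \<Phi> k1 k2 k3 L
      \<le> ennreal ((kt1 - sqrt (kt1\<^sup>2 - 8 * kt2)) * kt3 * Tt / (2 * B) * (\<gamma> / (\<gamma> - L)))"
    using \<gamma> by (simp add: s_def)
next
  fix C
  have "kt2 > 0" "kt3 > 0" using assms by (auto simp: normalized_params_def)
  from tendsto_mult_right[OF T_tilde_bound_tendsto[OF this assms(5), of C], of "\<gamma> / (\<gamma> - L)"]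
  show "((\<lambda>\<kappa>. (\<kappa> - sqrt (\<kappa>\<^sup>2 - 8 * kt2)) * kt3 * T_tilde B C \<kappa> kt2 kt3 / (2 * B) * (\<gamma> / (\<gamma> - L)))
           \<longlongrightarrow> \<gamma> / (\<gamma> - L)) at_top"
    by simp
qed

end
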